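(* Let $U\subset \mathrm{Sym}(2,\mathbb{R})\setminus L$ be open and let $E:U\to T\,\mathrm{Sym}(2,\mathbb{R})$, $E(x,y,z)=E^1(x,y,z)\,e_1+E^2(x,y,z)\,e_2$, be a smooth vector field on $U$ with component functions $E^1,E^2:U\to\mathbb{R}$ such that for each $(x,y,z)\in U$ the vector $(E^1(x,y,z),E^2(x,y,z))^\top\in\mathbb{R}^2$ is a unit-length (in the Euclidean norm) eigenvector of the matrix $\begin{pmatrix} x+z & y \\ y & -x+z\end{pmatrix}$. Then $\nabla E\equiv0$ on $U$, where $\nabla$ is the Levi-Civita connection of the metric $g$ defined in the context.
   Context: $\mathrm{Sym}(2,\mathbb{R})$ is the space of real symmetric $2\times2$ matrices, identified with $\mathbb{R}^3$ via global coordinates $(x,y,z)\leftrightarrow\begin{pmatrix} x+z & y \\ y & -x+z\end{pmatrix}$. Cylindrical coordinates $(r,\phi,z)$ are given by $(x,y)=(r\cos\phi,r\sin\phi)$, with $\partial_r=\cos\phi\,\partial_x+\sin\phi\,\partial_y$ and $\partial_\phi=-r\sin\phi\,\partial_x+r\cos\phi\,\partial_y$. The singular line is $L=\{(0,0,z):z\in\mathbb{R}\}$. The metric on $\mathrm{Sym}(2,\mathbb{R})\setminus L$ is, in coordinates $(x,y,z)$, $g=\begin{pmatrix}1+3x^2/r^2&3xy/r^2&0\\3xy/r^2&1+3y^2/r^2&0\\0&0&1\end{pmatrix}$. The $g$-orthonormal reference frame on $\mathrm{Sym}(2,\mathbb{R})\setminus L$ is $e_1=\cos\phi\,\frac{\partial_r}{2}-\sin\phi\,\frac{\partial_\phi}{r}$,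 $e_2=\sin\phi\,\frac{\partial_r}{2}+\cos\phi\,\frac{\partial_\phi}{r}$, $e_3=\partial_z$. *)

theory Defs
  imports "HOL-Analysis.Analysis"
begin

section \<open>Smooth maps on open sets\<close>

fun differentiable_n_on ::
    "nat \<Rightarrow> 'a::euclidean_space set \<Rightarrow> ('a \<Rightarrow> 'b::real_normed_vector) \<Rightarrow> bool" where
  "differentiable_n_on 0 U f \<longleftrightarrow> continuous_on U f"
| "differentiable_n_on (Suc n) U f \<longleftrightarrow>
     (\<forall>p\<in>U. f differentiable (at p)) \<and>
     (\<forall>v. differentiable_n_on n U (\<lambda>p. frechet_derivative f (at p) v))"

text \<open>The class \<open>C\<^sup>\<infinity>\<close>, for open \<open>U\<close>.\<close>

definition smooth_on :: "'a::euclidean_space set \<Rightarrow> ('a \<Rightarrow> 'b::real_normed_vector) \<Rightarrow> bool" where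
  "smooth_on U f \<longleftrightarrow> (\<forall>n. differentiable_n_on n U f)"


section \<open>Levi-Civita connections on open subsets of a Euclidean space\<close>

text \<open>Vector fields on an open set \<open>U\<close> are given by their components in the global coordinates,
  so they are maps \<open>'a \<Rightarrow> 'a\<close> of which only the values on \<open>U\<close> matter.\<close>

definition dir_deriv ::
    "('a::euclidean_space \<Rightarrow> 'a) \<Rightarrow> ('a \<Rightarrow> 'b::real_normed_vector) \<Rightarrow> 'a \<Rightarrow> 'b" where
  "dir_deriv X f p = frechet_derivative f (at p) (X p)"

definition lie_bracket ::
    "('a::euclidean_space \<Rightarrow> 'a) \<Rightarrow> ('a \<Rightarrow> 'a) \<Rightarrow> 'a \<Rightarrow> 'a" where
  "lie_bracket X Y p = dir_deriv X Y p - dir_deriv Y X p"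

text \<open>Real-linearity in \<open>Y\<close> is additivity together with the Leibniz rule for constant \<open>f\<close>.\<close>

definition affine_connection_on ::
    "'a::euclidean_space set \<Rightarrow> (('a \<Rightarrow> 'a) \<Rightarrow> ('a \<Rightarrow> 'a) \<Rightarrow> 'a \<Rightarrow> 'a) \<Rightarrow> bool" where
  "affine_connection_on U nabla \<longleftrightarrow>
     (\<forall>X Y. smooth_on U X \<longrightarrow> smooth_on U Y \<longrightarrow> smooth_on U (nabla X Y)) \<and>
     (\<forall>X X' Y. smooth_on U X \<longrightarrow> smooth_on U X' \<longrightarrow> smooth_on U Y \<longrightarrow>
        (\<forall>p\<in>U. nabla (\<lambda>q. X q + X' q) Y p = nabla X Y p + nabla X' Y p)) \<and>
     (\<forall>(f :: 'a \<Rightarrow> real) X Y. smooth_on U f \<longrightarrow> smooth_on U X \<longrightarrow> smooth_on U Y \<longrightarrow>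
        (\<forall>p\<in>U. nabla (\<lambda>q. f q *\<^sub>R X q) Y p = f p *\<^sub>R nabla X Y p)) \<and>
     (\<forall>X Y Y'. smooth_on U X \<longrightarrow> smooth_on U Y \<longrightarrow> smooth_on U Y' \<longrightarrow>
        (\<forall>p\<in>U. nabla X (\<lambda>q. Y q + Y' q) p = nabla X Y p + nabla X Y' p)) \<and>
     (\<forall>(f :: 'a \<Rightarrow> real) X Y. smooth_on U f \<longrightarrow> smooth_on U X \<longrightarrow> smooth_on U Y \<longrightarrow>
        (\<forall>p\<in>U. nabla X (\<lambda>q. f q *\<^sub>R Y q) p = dir_deriv X f p *\<^sub>R Y p + f p *\<^sub>R nabla X Y p))"

definition torsion_free_on ::
    "'a::euclidean_space set \<Rightarrow> (('a \<Rightarrow> 'a) \<Rightarrow> ('a \<Rightarrow> 'a) \<Rightarrow> 'a \<Rightarrow> 'a) \<Rightarrow> bool" where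
  "torsion_free_on U nabla \<longleftrightarrow>
     (\<forall>X Y. smooth_on U X \<longrightarrow> smooth_on U Y \<longrightarrow>
        (\<forall>p\<in>U. nabla X Y p - nabla Y X p = lie_bracket X Y p))"

definition metric_compatible_on ::
    "'a::euclidean_space set \<Rightarrow> ('a \<Rightarrow> 'a \<Rightarrow> 'a \<Rightarrow> real) \<Rightarrow>
     (('a \<Rightarrow> 'a) \<Rightarrow> ('a \<Rightarrow> 'a) \<Rightarrow> 'a \<Rightarrow> 'a) \<Rightarrow> bool" where
  "metric_compatible_on U g nabla \<longleftrightarrow>
     (\<forall>X Y Z. smooth_on U X \<longrightarrow> smooth_on U Y \<longrightarrow> smooth_on U Z \<longrightarrow>
        (\<forall>p\<in>U. dir_deriv X (\<lambda>q. g q (Y q) (Z q)) p =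
                g p (nabla X Y p) (Z p) + g p (Y p) (nabla X Z p)))"

text \<open>For a nondegenerate symmetric \<open>g\<close> these axioms determine \<open>nabla X Y\<close> on \<open>U\<close> for smooth
  \<open>X\<close> and \<open>Y\<close>; nothing is required of \<open>nabla\<close> elsewhere.\<close>

definition levi_civita_on ::
    "'a::euclidean_space set \<Rightarrow> ('a \<Rightarrow> 'a \<Rightarrow> 'a \<Rightarrow> real) \<Rightarrow>
     (('a \<Rightarrow> 'a) \<Rightarrow> ('a \<Rightarrow> 'a) \<Rightarrow> 'a \<Rightarrow> 'a) \<Rightarrow> bool" where
  "levi_civita_on U g nabla \<longleftrightarrow>
     affine_connection_on U nabla \<and> torsion_free_on U nabla \<and> metric_compatible_on U g nabla"


section \<open>The metric and the reference frame on the symmetric matrices\<close>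

text \<open>The coordinates \<open>(x, y, z)\<close> of a point \<open>p\<close> are \<open>p $ 1\<close>, \<open>p $ 2\<close>, \<open>p $ 3\<close>.\<close>

definition sym_matrix :: "real^3 \<Rightarrow> real^2^2" where
  "sym_matrix p = vector [vector [p $ 1 + p $ 3, p $ 2],
                          vector [p $ 2, - p $ 1 + p $ 3]]"

definition singular_line :: "(real^3) set" where
  "singular_line = {p. p $ 1 = 0 \<and> p $ 2 = 0}"

text \<open>The angle \<open>\<phi>\<close> enters only through its cosine and sine, which
  \<open>(x, y) = (r cos \<phi>, r sin \<phi>)\<close> determines off the singular line.\<close>

definition cyl_r :: "real^3 \<Rightarrow> real" where
  "cyl_r p = sqrt ((p $ 1)\<^sup>2 + (p $ 2)\<^sup>2)"

definition cos_phi :: "real^3 \<Rightarrow> real" where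
  "cos_phi p = p $ 1 / cyl_r p"

definition sin_phi :: "real^3 \<Rightarrow> real" where
  "sin_phi p = p $ 2 / cyl_r p"

definition partial_r :: "real^3 \<Rightarrow> real^3" where
  "partial_r p = vector [cos_phi p, sin_phi p, 0]"

definition partial_phi :: "real^3 \<Rightarrow> real^3" where
  "partial_phi p = vector [- cyl_r p * sin_phi p, cyl_r p * cos_phi p, 0]"

definition frame1 :: "real^3 \<Rightarrow> real^3" where
  "frame1 p = cos_phi p *\<^sub>R (partial_r p /\<^sub>R 2) - sin_phi p *\<^sub>R (partial_phi p /\<^sub>R cyl_r p)"

definition frame2 :: "real^3 \<Rightarrow> real^3" where
  "frame2 p = sin_phi p *\<^sub>R (partial_r p /\<^sub>R 2) + cos_phi p *\<^sub>R (partial_phi p /\<^sub>R cyl_r p)"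

definition sym_metric_matrix :: "real^3 \<Rightarrow> real^3^3" where
  "sym_metric_matrix p =
     vector [vector [1 + 3 * (p $ 1)\<^sup>2 / (cyl_r p)\<^sup>2, 3 * p $ 1 * p $ 2 / (cyl_r p)\<^sup>2, 0],
             vector [3 * p $ 1 * p $ 2 / (cyl_r p)\<^sup>2, 1 + 3 * (p $ 2)\<^sup>2 / (cyl_r p)\<^sup>2, 0],
             vector [0, 0, 1]]"

definition sym_metric :: "real^3 \<Rightarrow> real^3 \<Rightarrow> real^3 \<Rightarrow> real" where
  "sym_metric p v w = v \<bullet> (sym_metric_matrix p *v w)"

end

theory Submission
  imports Defs
begin

text \<open>Off the singular line the metric is \<open>4 dr\<^sup>2 + r\<^sup>2 d\<phi>\<^sup>2 + dz\<^sup>2\<close>, a flat cone. The eigenvector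
  condition makes the angle of \<open>(E\<^sup>1, E\<^sup>2)\<close> equal to \<open>\<phi>/2\<close> up to a locally constant multiple of
  \<open>\<pi>/2\<close>, so relative to the polar frame \<open>(\<partial>\<^sub>r/2, \<partial>\<^sub>\<phi>/r)\<close> the field \<open>E\<close> has an angle with derivative
  \<open>- d\<phi>/2\<close>, which is the rate of a parallel field on this cone. The rate is obtained
  by differentiating the polynomial constraints on \<open>E\<close>; the Koszul formula, tested
  against constant fields, then gives \<open>\<nabla>E = 0\<close>.\<close>

section \<open>Smooth maps and the Koszul formula\<close>

lemma smooth_on_const: "smooth_on U (\<lambda>_. c)"
proof -
  have "differentiable_n_on n U (\<lambda>_. c)" for n
    by (induction n arbitrary: c) auto
  then show ?thesis
    by (simp add: smooth_on_def)
qed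

lemma smooth_on_has_derivative:
  assumes "smooth_on U f" "p \<in> U"
  shows "(f has_derivative frechet_derivative f (at p)) (at p)"
proof -
  have "differentiable_n_on (Suc 0) U f"
    using assms(1) unfolding smooth_on_def by blast
  then show ?thesis
    using assms(2) by (simp add: frechet_derivative_works)
qed

text \<open>Metric compatibility expands the three derivatives and vanishing torsion expands the
  brackets; all terms then cancel except two copies of
  \<open>g p (nabla X Y p) (Z p)\<close>.\<close>

lemma koszul_formula:
  assumes "metric_compatible_on U g nabla" "torsion_free_on U nabla"
    and X: "smooth_on U X" and Y: "smooth_on U Y" and Z: "smooth_on U Z" and p: "p \<in> U"
    and "bilinear (g p)" and sym: "\<And>v w. g p v w = g p w v"
  shows "2 * g p (nabla X Y p) (Z p) =
    dir_deriv X (\<lambda>q. g q (Y q) (Z q)) p + dir_deriv Y (\<lambda>q. g q (X q) (Z q)) p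
    - dir_deriv Z (\<lambda>q. g q (X q) (Y q)) p
    + g p (lie_bracket X Y p) (Z p) - g p (lie_bracket X Z p) (Y p) - g p (lie_bracket Y Z p) (X p)"
proof -
  have compat: "dir_deriv A (\<lambda>q. g q (B q) (C q)) p = g p (nabla A B p) (C p) + g p (B p) (nabla A C p)"
    if "smooth_on U A" "smooth_on U B" "smooth_on U C" for A B C
    using assms(1) that p unfolding metric_compatible_on_def by blast
  have torsion: "g p (lie_bracket A B p) w = g p (nabla A B p) w - g p (nabla B A p) w"
    if "smooth_on U A" "smooth_on U B" for A B w
    using assms(2) that p bilinear_lsub[OF assms(7)] unfolding torsion_free_on_def by metis
  show ?thesis
    by (simp add: compat torsion X Y Z sym[of "X p"] sym[of "Y p"])
qed

section \<open>The metric in polar components\<close>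

text \<open>This is the one-form dr. Since \<open>\<partial>\<^sub>r/2\<close> is the unit vector,
  the orthonormal radial component is twice this value.\<close>

definition radial_part :: "real^3 \<Rightarrow> real^3 \<Rightarrow> real" where
  "radial_part p v = cos_phi p * v $ 1 + sin_phi p * v $ 2"

text \<open>This is r d\<phi>, the component along the unit vector
  \<open>\<partial>\<^sub>\<phi>/r\<close>.\<close>

definition angular_part :: "real^3 \<Rightarrow> real^3 \<Rightarrow> real" where
  "angular_part p v = cos_phi p * v $ 2 - sin_phi p * v $ 1"

definition dphi :: "real^3 \<Rightarrow> real^3 \<Rightarrow> real" where
  "dphi p v = angular_part p v / cyl_r p"

text \<open>The metric matrix is the identity plus three times the square of dr. On the singular
  line division by zero gives 0, and both sides are the Euclidean product.\<close>

lemma sym_metric_eq: "sym_metric p v w = v \<bullet> w + 3 * radial_part p v * radial_part p w"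
  by (simp add: sym_metric_def sym_metric_matrix_def radial_part_def cos_phi_def sin_phi_def
      matrix_vector_mult_def inner_vec_def sum_3 power2_eq_square add_divide_distrib algebra_simps)

lemma sym_metric_sym: "sym_metric p v w = sym_metric p w v"
  by (simp add: sym_metric_eq inner_commute)

lemma bilinear_sym_metric: "bilinear (sym_metric p)"
  unfolding bilinear_def
  by (auto intro!: linearI simp: sym_metric_eq radial_part_def inner_add_left inner_add_right algebra_simps)

lemma sym_metric_self_eq_0:
  assumes "sym_metric p v v = 0"
  shows "v = 0"
proof -
  have "v \<bullet> v + 3 * (radial_part p v)\<^sup>2 = 0"
    using assms by (simp add: sym_metric_eq power2_eq_square)
  moreover have "v \<bullet> v \<ge> 0" "3 * (radial_part p v)\<^sup>2 \<ge> 0"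
    by simp_all
  ultimately show ?thesis
    by (simp add: add_nonneg_eq_0_iff)
qed

lemma cyl_r_pos: "p \<notin> singular_line \<Longrightarrow> cyl_r p > 0"
  by (auto simp: singular_line_def cyl_r_def sum_power2_gt_zero_iff)

lemma cos_sin_phi_squared:
  assumes "p \<notin> singular_line"
  shows "(cos_phi p)\<^sup>2 + (sin_phi p)\<^sup>2 = 1"
proof -
  have "(p $ 1)\<^sup>2 + (p $ 2)\<^sup>2 = (cyl_r p)\<^sup>2"
    by (simp add: cyl_r_def)
  then show ?thesis
    using cyl_r_pos[OF assms]
    by (simp add: cos_phi_def sin_phi_def power_divide add_divide_distrib[symmetric])
qed

lemma coords_eq:
  assumes "p \<notin> singular_line"
  shows "p $ 1 = cyl_r p * cos_phi p" "p $ 2 = cyl_r p * sin_phi p"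
  using cyl_r_pos[OF assms] by (simp_all add: cos_phi_def sin_phi_def)

section \<open>Derivatives of the polar data\<close>

lemma has_derivative_cyl_r:
  assumes "p \<notin> singular_line"
  shows "(cyl_r has_derivative radial_part p) (at p)"
proof -
  have "(p $ 1)\<^sup>2 + (p $ 2)\<^sup>2 > 0"
    using cyl_r_pos[OF assms] by (simp add: cyl_r_def)
  then have "((\<lambda>q. sqrt ((q $ 1)\<^sup>2 + (q $ 2)\<^sup>2)) has_derivative
      (\<lambda>v. (2 * p $ 1 * v $ 1 + 2 * p $ 2 * v $ 2) * (inverse (cyl_r p) / 2))) (at p)"
    by (auto intro!: derivative_eq_intros bounded_linear.has_derivative[OF bounded_linear_vec_nth]
        simp: cyl_r_def field_simps)
  moreover have "(\<lambda>v. (2 * p $ 1 * v $ 1 + 2 * p $ 2 * v $ 2) * (inverse (cyl_r p) / 2)) = radial_part p"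
    using cyl_r_pos[OF assms] by (auto simp: radial_part_def cos_phi_def sin_phi_def field_simps)
  ultimately show ?thesis
    by (simp add: cyl_r_def[abs_def])
qed

lemma has_derivative_cos_phi:
  assumes "p \<notin> singular_line"
  shows "(cos_phi has_derivative (\<lambda>v. - sin_phi p * dphi p v)) (at p)"
proof -
  note pos = cyl_r_pos[OF assms]
  have "((\<lambda>q. q $ 1 / cyl_r q) has_derivative
      (\<lambda>v. (v $ 1 * cyl_r p - p $ 1 * radial_part p v) / (cyl_r p * cyl_r p))) (at p)"
    using pos by (intro has_derivative_divide' has_derivative_cyl_r[OF assms]
        bounded_linear.has_derivative[OF bounded_linear_vec_nth] has_derivative_ident) simp
  moreover have "(v $ 1 * cyl_r p - p $ 1 * radial_part p v) / (cyl_r p * cyl_r p) = - sin_phi p * dphi p v" for v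
  proof -
    \<comment> \<open>Removing the radial projection from \<open>v\<close> leaves, in the plane, its
      angular component; this is the first coordinate.\<close>
    have "v $ 1 - cos_phi p * radial_part p v = - sin_phi p * angular_part p v"
      using cos_sin_phi_squared[OF assms] unfolding radial_part_def angular_part_def by algebra
    moreover have "(v $ 1 * cyl_r p - p $ 1 * radial_part p v) / (cyl_r p * cyl_r p)
        = (v $ 1 - cos_phi p * radial_part p v) / cyl_r p"
      using pos by (simp add: coords_eq(1)[OF assms] field_simps)
    ultimately show ?thesis
      by (simp add: dphi_def)
  qed
  ultimately show ?thesis
    by (simp add: cos_phi_def[abs_def])
qed

lemma has_derivative_sin_phi:
  assumes "p \<notin> singular_line"
  shows "(sin_phi has_derivative (\<lambda>v. cos_phi p * dphi p v)) (at p)"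
proof -
  note pos = cyl_r_pos[OF assms]
  have "((\<lambda>q. q $ 2 / cyl_r q) has_derivative
      (\<lambda>v. (v $ 2 * cyl_r p - p $ 2 * radial_part p v) / (cyl_r p * cyl_r p))) (at p)"
    using pos by (intro has_derivative_divide' has_derivative_cyl_r[OF assms]
        bounded_linear.has_derivative[OF bounded_linear_vec_nth] has_derivative_ident) simp
  moreover have "(v $ 2 * cyl_r p - p $ 2 * radial_part p v) / (cyl_r p * cyl_r p) = cos_phi p * dphi p v" for v
  proof -
    have "v $ 2 - sin_phi p * radial_part p v = cos_phi p * angular_part p v"
      using cos_sin_phi_squared[OF assms] unfolding radial_part_def angular_part_def by algebra
    moreover have "(v $ 2 * cyl_r p - p $ 2 * radial_part p v) / (cyl_r p * cyl_r p)
        = (v $ 2 - sin_phi p * radial_part p v) / cyl_r p"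
      using pos by (simp add: coords_eq(2)[OF assms] field_simps)
    ultimately show ?thesis
      by (simp add: dphi_def)
  qed
  ultimately show ?thesis
    by (simp add: sin_phi_def[abs_def])
qed

text \<open>Product rule: besides \<open>Y\<close>, the polar directions turn at rate d\<phi>, which
  brings in the angular component.\<close>

lemma has_derivative_radial_part:
  assumes "p \<notin> singular_line" "(Y has_derivative Y') (at p)"
  shows "((\<lambda>q. radial_part q (Y q)) has_derivative
    (\<lambda>v. radial_part p (Y' v) + dphi p v * angular_part p (Y p))) (at p)"
  unfolding radial_part_def
  by (rule derivative_eq_intros has_derivative_cos_phi has_derivative_sin_phi
      bounded_linear.has_derivative[OF bounded_linear_vec_nth] assms refl)+
     (simp add: angular_part_def fun_eq_iff algebra_simps)

lemma has_derivative_angular_part: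
  assumes "p \<notin> singular_line" "(Y has_derivative Y') (at p)"
  shows "((\<lambda>q. angular_part q (Y q)) has_derivative
    (\<lambda>v. angular_part p (Y' v) - dphi p v * radial_part p (Y p))) (at p)"
  unfolding angular_part_def
  by (rule derivative_eq_intros has_derivative_cos_phi has_derivative_sin_phi
      bounded_linear.has_derivative[OF bounded_linear_vec_nth] assms refl)+
     (simp add: radial_part_def fun_eq_iff algebra_simps)

section \<open>The Levi-Civita connection of the metric\<close>

text \<open>The Euclidean summand of the metric has constant coefficients, so the correction comes
  only from differentiating the form dr in the other summand.\<close>

lemma dir_deriv_sym_metric:
  assumes "p \<notin> singular_line"
    and Y: "(Y has_derivative Y') (at p)" and Z: "(Z has_derivative Z') (at p)"
  shows "dir_deriv X (\<lambda>q. sym_metric q (Y q) (Z q)) p =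
    sym_metric p (Y' (X p)) (Z p) + sym_metric p (Y p) (Z' (X p))
    + 3 * dphi p (X p) * (angular_part p (Y p) * radial_part p (Z p)
                          + radial_part p (Y p) * angular_part p (Z p))"
proof -
  have "((\<lambda>q. sym_metric q (Y q) (Z q)) has_derivative
      (\<lambda>v. sym_metric p (Y' v) (Z p) + sym_metric p (Y p) (Z' v)
        + 3 * dphi p v * (angular_part p (Y p) * radial_part p (Z p)
                          + radial_part p (Y p) * angular_part p (Z p)))) (at p)"
    unfolding sym_metric_eq
    by (rule derivative_eq_intros has_derivative_radial_part assms refl)+
       (simp add: fun_eq_iff algebra_simps)
  from frechet_derivative_at[OF this, symmetric] show ?thesis
    by (simp add: dir_deriv_def)
qed

text \<open>Koszul formula with the constant field \<open>w\<close> as third argument: the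
  derivatives of \<open>X\<close> cancel against the brackets, that of \<open>Y\<close> is doubled,
  and the d\<phi> terms play the part of Christoffel symbols.\<close>

lemma sym_metric_levi_civita:
  assumes "levi_civita_on U sym_metric nabla" "p \<in> U" "p \<notin> singular_line"
    and X: "smooth_on U X" and Y: "smooth_on U Y"
  shows "2 * sym_metric p (nabla X Y p) w =
    2 * sym_metric p (dir_deriv X Y p) w
    + 3 * dphi p (X p) * (angular_part p (Y p) * radial_part p w + radial_part p (Y p) * angular_part p w)
    + 3 * dphi p (Y p) * (angular_part p (X p) * radial_part p w + radial_part p (X p) * angular_part p w)
    - 3 * dphi p w * (angular_part p (X p) * radial_part p (Y p) + radial_part p (X p) * angular_part p (Y p))"
proof -
  note X' = smooth_on_has_derivative[OF X assms(2)] and Y' = smooth_on_has_derivative[OF Y assms(2)]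
  note lin = bilinear_lsub[OF bilinear_sym_metric] bilinear_lzero[OF bilinear_sym_metric]
    bilinear_rzero[OF bilinear_sym_metric] bilinear_lneg[OF bilinear_sym_metric]
  have "metric_compatible_on U sym_metric nabla" "torsion_free_on U nabla"
    using assms(1) by (simp_all add: levi_civita_on_def)
  from koszul_formula[OF this X Y smooth_on_const[where c = w] assms(2) bilinear_sym_metric sym_metric_sym]
  show ?thesis
    unfolding dir_deriv_sym_metric[OF assms(3) X' Y']
      dir_deriv_sym_metric[OF assms(3) X' has_derivative_const]
      dir_deriv_sym_metric[OF assms(3) Y' has_derivative_const]
    by (simp add: lie_bracket_def lin dir_deriv_def sym_metric_sym[of p "X p"] algebra_simps)
qed

section \<open>Eigenvector fields in the polar frame\<close>

text \<open>The frame \<open>frame1\<close>, \<open>frame2\<close> is the orthonormal polar frame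
  turned by -\<phi>, so the polar components of \<open>v\<close> are \<open>(a, b)\<close> rotated
  by -\<phi>.\<close>

lemma frame_parts:
  assumes "p \<notin> singular_line" and v: "v = a *\<^sub>R frame1 p + b *\<^sub>R frame2 p"
  shows "2 * radial_part p v = a * cos_phi p + b * sin_phi p"
    and "angular_part p v = b * cos_phi p - a * sin_phi p"
    and "v $ 3 = 0"
proof -
  have "v $ 1 = a * ((cos_phi p)\<^sup>2 / 2 + (sin_phi p)\<^sup>2) + b * (- cos_phi p * sin_phi p / 2)"
    and "v $ 2 = a * (- cos_phi p * sin_phi p / 2) + b * ((sin_phi p)\<^sup>2 / 2 + (cos_phi p)\<^sup>2)"
    using cyl_r_pos[OF assms(1)]
    by (simp_all add: v frame1_def frame2_def partial_r_def partial_phi_def field_simps power2_eq_square)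
  then show "2 * radial_part p v = a * cos_phi p + b * sin_phi p"
    and "angular_part p v = b * cos_phi p - a * sin_phi p"
    using cos_sin_phi_squared[OF assms(1)]
    unfolding radial_part_def angular_part_def by algebra+
  show "v $ 3 = 0"
    by (simp add: v frame1_def frame2_def partial_r_def partial_phi_def)
qed

text \<open>If \<open>(a, b)\<close> has angle \<alpha>, the eigenvector condition says
  sin(2\<alpha> - \<phi>) = 0. The polar components have angle \<beta> = \<alpha> - \<phi>, which
  turns it into sin(2\<beta> + \<phi>) = 0, expanded here by the double-angle formulas.\<close>

lemma eigenvector_parts:
  assumes "p \<notin> singular_line" and v: "v = a *\<^sub>R frame1 p + b *\<^sub>R frame2 p"
    and n: "norm (vector [a, b] :: real^2) = 1"
    and ev: "sym_matrix p *v (vector [a, b] :: real^2) = c *\<^sub>R vector [a, b]"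
  shows "(2 * radial_part p v)\<^sup>2 + (angular_part p v)\<^sup>2 = 1"
    and "sin_phi p * ((2 * radial_part p v)\<^sup>2 - (angular_part p v)\<^sup>2)
       + 2 * cos_phi p * (2 * radial_part p v) * angular_part p v = 0"
proof -
  have ab: "a\<^sup>2 + b\<^sup>2 = 1"
    using n by (simp add: norm_vec_def L2_set_def sum_2)
  have "(p $ 1 + p $ 3) * a + p $ 2 * b = c * a" "p $ 2 * a + (- p $ 1 + p $ 3) * b = c * b"
    using ev by (simp_all add: vec_eq_iff forall_2 sym_matrix_def matrix_vector_mult_def sum_2)
  \<comment> \<open>Cross-multiplying by \<open>b\<close> and \<open>a\<close> eliminates the
    eigenvalue \<open>c\<close>, and \<open>p $ 3\<close> with it.\<close>
  then have "p $ 2 * (a\<^sup>2 - b\<^sup>2) = 2 * p $ 1 * a * b"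
    by algebra
  then have "cyl_r p * (sin_phi p * (a\<^sup>2 - b\<^sup>2)) = cyl_r p * (2 * cos_phi p * a * b)"
    using coords_eq[OF assms(1)] by (simp add: mult_ac)
  then have eq: "sin_phi p * (a\<^sup>2 - b\<^sup>2) = 2 * cos_phi p * a * b"
    using cyl_r_pos[OF assms(1)] by simp
  show "(2 * radial_part p v)\<^sup>2 + (angular_part p v)\<^sup>2 = 1"
    unfolding frame_parts[OF assms(1) v] using ab cos_sin_phi_squared[OF assms(1)] by algebra
  show "sin_phi p * ((2 * radial_part p v)\<^sup>2 - (angular_part p v)\<^sup>2)
       + 2 * cos_phi p * (2 * radial_part p v) * angular_part p v = 0"
    unfolding frame_parts[OF assms(1) v] using eq cos_sin_phi_squared[OF assms(1)] by algebra
qed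

text \<open>With \<open>(P, T)\<close> = (cos \<beta>, sin \<beta>) and \<open>\<theta>\<close> the
  rate of \<phi>, \<open>d1\<close> and \<open>d2\<close> are the derivatives of the two
  constraints; sin(2\<beta> + \<phi>) = 0 forces \<beta> to move at rate
  \<open>- \<theta> / 2\<close>.\<close>

lemma half_angle_rate:
  fixes c s P T :: real
  assumes "c\<^sup>2 + s\<^sup>2 = 1" and PT: "P\<^sup>2 + T\<^sup>2 = 1" and eq: "s * (P\<^sup>2 - T\<^sup>2) + 2 * c * P * T = 0"
    and d1: "P * P' + T * T' = 0"
    and d2: "c * \<theta> * (P\<^sup>2 - T\<^sup>2) + s * (2 * P * P' - 2 * T * T')
      - 2 * s * \<theta> * P * T + 2 * c * (P' * T + P * T') = 0"
  shows "2 * P' = T * \<theta>" "2 * T' = - P * \<theta>"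
proof -
  \<comment> \<open>The rate of \<beta>.\<close>
  define \<omega> where "\<omega> = P * T' - T * P'"
  have rot: "P' = - T * \<omega>" "T' = P * \<omega>"
    using PT d1 unfolding \<omega>_def by algebra+
  \<comment> \<open>This is cos(2\<beta> + \<phi>), which is 1 or -1 because the corresponding sine
    vanishes.\<close>
  define K where "K = c * (P\<^sup>2 - T\<^sup>2) - 2 * s * P * T"
  have "K\<^sup>2 = 1"
    using assms(1) PT eq unfolding K_def by algebra
  then have "K \<noteq> 0"
    by auto
  moreover have "K * (\<theta> + 2 * \<omega>) = 0"
    using d2 unfolding rot K_def by algebra
  ultimately have "\<theta> = - 2 * \<omega>"
    by simp
  then show "2 * P' = T * \<theta>" "2 * T' = - P * \<theta>"
    by (simp_all add: rot)
qed

lemma has_derivative_eq_0_if_zero_on: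
  assumes "(f has_derivative f') (at p)" "open U" "p \<in> U" "\<And>q. q \<in> U \<Longrightarrow> f q = 0"
  shows "f' v = 0"
proof -
  have "((\<lambda>_. 0) has_derivative f') (at p)"
    using has_derivative_transform_within_open[OF assms(1-3)] assms(4) by auto
  then have "f' = (\<lambda>_. 0)"
    using has_derivative_unique has_derivative_const by blast
  then show ?thesis
    by simp
qed

section \<open>Parallelism of the eigenvector field\<close>

theorem proposition15:
  fixes U :: "(real^3) set"
    and E :: "real^3 \<Rightarrow> real^3"
    and E1 E2 :: "real^3 \<Rightarrow> real"
    and nabla :: "(real^3 \<Rightarrow> real^3) \<Rightarrow> (real^3 \<Rightarrow> real^3) \<Rightarrow> real^3 \<Rightarrow> real^3"
  assumes "open U" and "U \<subseteq> - singular_line"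
    and "smooth_on U E"
    and "\<And>p. p \<in> U \<Longrightarrow> E p = E1 p *\<^sub>R frame1 p + E2 p *\<^sub>R frame2 p"
    and "\<And>p. p \<in> U \<Longrightarrow> norm (vector [E1 p, E2 p] :: real^2) = 1 \<and>
           (\<exists>c. sym_matrix p *v (vector [E1 p, E2 p] :: real^2) = c *\<^sub>R vector [E1 p, E2 p])"
    and "levi_civita_on U sym_metric nabla"
  shows "\<forall>X. smooth_on U X \<longrightarrow> (\<forall>p\<in>U. nabla X E p = 0)"
proof (intro allI impI ballI)
  fix X :: "real^3 \<Rightarrow> real^3" and p
  assume X: "smooth_on U X" and p: "p \<in> U"
  have off: "q \<notin> singular_line" if "q \<in> U" for q
    using assms(2) that by blast
  define D where "D = frechet_derivative E (at p)"
  have D: "(E has_derivative D) (at p)"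
    unfolding D_def by (rule smooth_on_has_derivative[OF assms(3) p])
  \<comment> \<open>\<open>P\<close> and \<open>T\<close> are the orthonormal polar components, read
    off from \<open>E\<close> itself so that its smoothness makes them differentiable;
    \<open>E1\<close> and \<open>E2\<close> enter only through pointwise identities.\<close>
  define P where "P = (\<lambda>q. 2 * radial_part q (E q))"
  define T where "T = (\<lambda>q. angular_part q (E q))"
  have unit: "(P q)\<^sup>2 + (T q)\<^sup>2 - 1 = 0"
    and eig: "sin_phi q * ((P q)\<^sup>2 - (T q)\<^sup>2) + 2 * cos_phi q * P q * T q = 0" if "q \<in> U" for q
    using eigenvector_parts[OF off[OF that] assms(4)[OF that]] assms(5)[OF that]
    unfolding P_def T_def by auto
  define P' where "P' = (\<lambda>v. 2 * (radial_part p (D v) + dphi p v * T p))"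
  define T' where "T' = (\<lambda>v. angular_part p (D v) - dphi p v * (P p / 2))"
  have derP: "(P has_derivative P') (at p)"
    unfolding P_def P'_def T_def
    by (rule has_derivative_mult_right has_derivative_radial_part off[OF p] D)+
  have derT: "(T has_derivative T') (at p)"
    using has_derivative_angular_part[OF off[OF p] D] unfolding P_def T'_def T_def by simp
  have "((\<lambda>q. (P q)\<^sup>2 + (T q)\<^sup>2 - 1) has_derivative (\<lambda>v. 2 * (P p * P' v + T p * T' v))) (at p)"
    by (rule derivative_eq_intros derP derT refl)+ (simp add: fun_eq_iff algebra_simps)
  then have "2 * (P p * P' v + T p * T' v) = 0" for v
    by (rule has_derivative_eq_0_if_zero_on[OF _ assms(1) p]) (rule unit)
  then have d1: "P p * P' v + T p * T' v = 0" for v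
    by (metis mult_eq_0_iff zero_neq_numeral)
  have "((\<lambda>q. sin_phi q * ((P q)\<^sup>2 - (T q)\<^sup>2) + 2 * cos_phi q * P q * T q) has_derivative
    (\<lambda>v. cos_phi p * dphi p v * ((P p)\<^sup>2 - (T p)\<^sup>2) + sin_phi p * (2 * P p * P' v - 2 * T p * T' v)
      - 2 * sin_phi p * dphi p v * P p * T p + 2 * cos_phi p * (P' v * T p + P p * T' v))) (at p)"
    by (rule derivative_eq_intros has_derivative_cos_phi has_derivative_sin_phi off[OF p] derP derT refl)+
       (simp add: fun_eq_iff algebra_simps)
  then have d2: "cos_phi p * dphi p v * ((P p)\<^sup>2 - (T p)\<^sup>2) + sin_phi p * (2 * P p * P' v - 2 * T p * T' v)
      - 2 * sin_phi p * dphi p v * P p * T p + 2 * cos_phi p * (P' v * T p + P p * T' v) = 0" for v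
    by (rule has_derivative_eq_0_if_zero_on[OF _ assms(1) p]) (rule eig)
  have "(P p)\<^sup>2 + (T p)\<^sup>2 = 1"
    using unit[OF p] by simp
  note rate = half_angle_rate[OF cos_sin_phi_squared[OF off[OF p]] this eig[OF p] d1 d2]
  \<comment> \<open>Solving \<open>2 * P' v = T p * dphi p v\<close> for the radial part of
    \<open>D v\<close>: the coefficient is 1/4 - 1.\<close>
  have radial: "radial_part p (D v) = - 3 / 4 * T p * dphi p v" for v
    using rate(1)[of v] unfolding P'_def by (simp add: algebra_simps)
  \<comment> \<open>The turning of the polar frame contributes \<open>- P p / 2 * dphi p v\<close>,
    already the whole half-angle rate.\<close>
  have angular: "angular_part p (D v) = 0" for v
    using rate(2)[of v] unfolding T'_def by (simp add: algebra_simps)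
  have "((\<lambda>q. E q $ 3) has_derivative (\<lambda>v. D v $ 3)) (at p)"
    by (rule bounded_linear.has_derivative[OF bounded_linear_vec_nth D])
  from has_derivative_eq_0_if_zero_on[OF this assms(1) p] frame_parts(3)[OF off assms(4)]
  have third: "D v $ 3 = 0" for v
    by blast
  have polar: "u \<bullet> w = radial_part p u * radial_part p w + angular_part p u * angular_part p w + u $ 3 * w $ 3"
    for u w
    using cos_sin_phi_squared[OF off[OF p]]
    unfolding radial_part_def angular_part_def inner_vec_def sum_3 inner_real_def by algebra
  \<comment> \<open>\<open>D v\<close> is purely radial, and the metric weighs radial parts by 1 + 3
    = 4.\<close>
  have metric: "sym_metric p (D v) w = - 3 * T p * dphi p v * radial_part p w" for v w
    unfolding sym_metric_eq polar radial angular third by simp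
  have "2 * sym_metric p (nabla X E p) w = 0" for w
    unfolding sym_metric_levi_civita[OF assms(6) p off[OF p] X assms(3)] dir_deriv_def
      D_def[symmetric] metric
    \<comment> \<open>Writing every d\<phi> as an angular part over r makes the flat derivative and
      the connection terms cancel.\<close>
    unfolding dphi_def T_def by (simp add: algebra_simps)
  then show "nabla X E p = 0"
    \<comment> \<open>Definiteness, with \<open>w\<close> taken to be
      \<open>nabla X E p\<close>.\<close>
    by (intro sym_metric_self_eq_0) simp
qed

end
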